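(* Let $d\in\mathbb N$, $d\ge 2$. Let $a_1,\ldots,a_d\in[0,1)$. For $\mathbb I\in\{0,1\}^d$ let $x_{\mathbb I}\in\prod_{i=1}^d\{a_i,1\}$ be the point with $k$-th coordinate $(x_{\mathbb I})_k=a_k$ if $\mathbb I_k=0$ and $(x_{\mathbb I})_k=1$ if $\mathbb I_k=1$. Let $q_{\mathbb I}\in[0,1]$, $\mathbb I\in\{0,1\}^d$, be real numbers such that $$0\le q_{\mathbb J}-q_{\mathbb I}\le 1-a_\ell\quad\text{for all }\ell=1,\ldots,d\text{ and all }\mathbb I,\mathbb J\in\{0,1\}^d\text{ with }\mathbb I\sim_\ell\mathbb J,$$ $$G_d(x_{\mathbb I})\le q_{\mathbb I}\le H_d(x_{\mathbb I})\quad\text{for all }\mathbb I\in\{0,1\}^d.$$ Then there exists a $d$-quasi-copula $Q:[0,1]^d\to[0,1]$ satisfying $Q(x_{\mathbb I})=q_{\mathbb I}$ for all $\mathbb I\in\{0,1\}^d$.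
   Context: A $d$-quasi-copula is a function $Q:[0,1]^d\to[0,1]$ such that: (BC) $Q(u_1,\ldots,u_d)=0$ whenever some $u_i=0$, and $Q(1,\ldots,1,u_i,1,\ldots,1)=u_i$ for every $i$ and every $u_i\in[0,1]$; (MC) $Q$ is nondecreasing in each variable; (LC) $|Q(u_1,\ldots,u_d)-Q(v_1,\ldots,v_d)|\le\sum_{i=1}^d|u_i-v_i|$ for all points of $[0,1]^d$. For multi-indices $\mathbb I,\mathbb J$ write $\mathbb I\sim_\ell\mathbb J$ if $\mathbb J-\mathbb I=\mathbb E^{(\ell)}$, where $\mathbb E^{(\ell)}$ is the multi-index whose only non-zero coordinate is the $\ell$-th one, equal to $1$. For $x=(x_1,\ldots,x_d)\in\mathbb R^d$: $G_d(x)=\sum_{i=1}^dx_i-d+1$ and $H_d(x)=\min\{x_1,\ldots,x_d\}$. *)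

theory Defs
  imports "HOL-Analysis.Analysis"
begin

definition unit_cube :: "(real ^ 'n::finite) set" where
  "unit_cube = {u. \<forall>i. u $ i \<in> {0..1}}"

text \<open>A function from the unit cube to the unit interval is represented by a total function on
  \<^typ>\<open>real ^ 'n\<close>; its values outside the unit cube are unconstrained.\<close>

definition boundary_condition :: "(real ^ 'n::finite \<Rightarrow> real) \<Rightarrow> bool" where
  "boundary_condition Q \<longleftrightarrow>
     (\<forall>u\<in>unit_cube. (\<exists>i. u $ i = 0) \<longrightarrow> Q u = 0) \<and>
     (\<forall>i. \<forall>t\<in>{0..1}. Q (\<chi> k. if k = i then t else 1) = t)"

definition monotonicity_condition :: "(real ^ 'n::finite \<Rightarrow> real) \<Rightarrow> bool" where
  "monotonicity_condition Q \<longleftrightarrow>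
     (\<forall>u\<in>unit_cube. \<forall>i. \<forall>t\<in>{0..1}. u $ i \<le> t \<longrightarrow> Q u \<le> Q (\<chi> k. if k = i then t else u $ k))"

definition lipschitz_condition :: "(real ^ 'n::finite \<Rightarrow> real) \<Rightarrow> bool" where
  "lipschitz_condition Q \<longleftrightarrow>
     (\<forall>u\<in>unit_cube. \<forall>v\<in>unit_cube. \<bar>Q u - Q v\<bar> \<le> (\<Sum>i\<in>UNIV. \<bar>u $ i - v $ i\<bar>))"

definition quasi_copula :: "(real ^ 'n::finite \<Rightarrow> real) \<Rightarrow> bool" where
  "quasi_copula Q \<longleftrightarrow>
     Q ` unit_cube \<subseteq> {0..1} \<and>
     boundary_condition Q \<and> monotonicity_condition Q \<and> lipschitz_condition Q"

text \<open>Multi-indices are integer vectors, so that the difference of two of them is not truncated.\<close>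

definition binary_indices :: "(int ^ 'n::finite) set" where
  "binary_indices = {I. \<forall>k. I $ k \<in> {0, 1}}"

definition adjacent_at :: "'n::finite \<Rightarrow> int ^ 'n \<Rightarrow> int ^ 'n \<Rightarrow> bool" where
  "adjacent_at l I J \<longleftrightarrow> J - I = axis l 1"

definition vertex :: "real ^ 'n::finite \<Rightarrow> int ^ 'n \<Rightarrow> real ^ 'n" where
  "vertex a I = (\<chi> k. if I $ k = 0 then a $ k else 1)"

definition G :: "real ^ 'n::finite \<Rightarrow> real" where
  "G x = (\<Sum>i\<in>UNIV. x $ i) - real CARD('n) + 1"

definition H :: "real ^ 'n::finite \<Rightarrow> real" where
  "H x = Min (range (\<lambda>i. x $ i))"

end

(* The quasi-copula is the largest candidate: the minimum of H and of the functions
   u |-> q_I + sum_k max(0, u_k - (x_I)_k).  Each of them changes from v to u by at most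
   sum_k max(0, u_k - v_k), a one-sided estimate that encodes both monotonicity and the Lipschitz
   condition and is inherited by minima.  The lower bound G on q_I gives the uniform margins, the
   upper bound H gives grounding, and walking along cube edges from I to I \/ J shows that the
   value at x_J is not pushed below q_J. *)

theory Submission
  imports Defs
begin

text \<open>An asymmetric l1 distance, zero exactly when \<open>u\<close> lies componentwise below
  \<open>v\<close>.\<close>

definition excess :: "real ^ 'n::finite \<Rightarrow> real ^ 'n \<Rightarrow> real" where
  "excess u v = (\<Sum>k\<in>UNIV. max 0 (u $ k - v $ k))"

lemma excess_nonneg: "0 \<le> excess u v"
  unfolding excess_def by (intro sum_nonneg) auto

lemma excess_triangle: "excess u w \<le> excess v w + excess u v"
  unfolding excess_def sum.distrib[symmetric] by (intro sum_mono) auto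

lemma component_diff_le_excess: "u $ i - v $ i \<le> excess u v"
proof -
  have "max 0 (u $ i - v $ i) \<le> excess u v"
    unfolding excess_def by (intro member_le_sum) auto
  then show ?thesis by simp
qed

lemma excess_eq_0: "(\<And>k. u $ k \<le> v $ k) \<Longrightarrow> excess u v = 0"
  by (simp add: excess_def)

lemma excess_le_l1: "excess u v \<le> (\<Sum>k\<in>UNIV. \<bar>u $ k - v $ k\<bar>)"
  unfolding excess_def by (intro sum_mono) auto

text \<open>Serves to compare \<open>G\<close> at two points, since \<open>G\<close> is the
  coordinate sum up to a constant.\<close>

lemma sum_diff_le_excess: "(\<Sum>k\<in>UNIV. u $ k) - (\<Sum>k\<in>UNIV. v $ k) \<le> excess u v"
  unfolding excess_def sum_subtractf[symmetric] by (intro sum_mono) auto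

text \<open>Take an index where \<open>g\<close> attains its minimum and compare there. This is how
  one-sided estimates pass to minima.\<close>

lemma Min_range_le_add:
  fixes f g :: "'i::finite \<Rightarrow> real"
  assumes "\<And>i. f i \<le> g i + c"
  shows "Min (range f) \<le> Min (range g) + c"
proof -
  have "Min (range g) \<in> range g" by (intro Min_in) auto
  then obtain i where "Min (range g) = g i" by (rule rangeE)
  moreover have "Min (range f) \<le> f i" by simp
  ultimately show ?thesis using assms[of i] by linarith
qed

lemma H_le_component: "H u \<le> u $ i"
  unfolding H_def by simp

lemma H_le_add_excess: "H u \<le> H v + excess u v"
  unfolding H_def
  by (intro Min_range_le_add) (use component_diff_le_excess[of u _ v] in \<open>simp add: algebra_simps\<close>)

text \<open>Raising a coordinate gives zero excess, hence monotonicity; the estimate in both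
  directions, with excess below the l1 distance, gives the Lipschitz bound. The bound by
  \<open>H\<close> yields grounding and the upper half of the margins.\<close>

lemma quasi_copulaI:
  fixes Q :: "real ^ 'n::finite \<Rightarrow> real"
  assumes excess: "\<And>u v. Q u \<le> Q v + excess u v"
    and nonneg: "\<And>u. u \<in> unit_cube \<Longrightarrow> 0 \<le> Q u"
    and le_H: "\<And>u. Q u \<le> H u"
    and margin: "\<And>i t. t \<in> {0..1} \<Longrightarrow> t \<le> Q (\<chi> k. if k = i then t else 1)"
  shows "quasi_copula Q"
proof -
  have le: "Q u \<le> u $ i" for u i
    using le_H[of u] H_le_component[of u i] by linarith
  have "Q ` unit_cube \<subseteq> {0..1}"
  proof clarify
    fix u :: "real ^ 'n" assume u: "u \<in> unit_cube"
    \<comment> \<open>\<open>undefined\<close> stands for an arbitrary coordinate: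
      \<open>Q u\<close> lies below every one.\<close>
    then have "u $ undefined \<le> 1" by (simp add: unit_cube_def)
    then show "Q u \<in> {0..1}" using nonneg[OF u] le[of u undefined] by simp
  qed
  moreover have "boundary_condition Q"
    unfolding boundary_condition_def
  proof (intro conjI ballI impI allI)
    fix u :: "real ^ 'n" assume u: "u \<in> unit_cube" and "\<exists>i. u $ i = 0"
    then obtain i where "u $ i = 0" by blast
    then show "Q u = 0" using nonneg[OF u] le[of u i] by simp
  next
    fix i :: 'n and t :: real assume "t \<in> {0..1}"
    then show "Q (\<chi> k. if k = i then t else 1) = t"
      using margin[of t i] le[of "\<chi> k. if k = i then t else 1" i] by simp
  qed
  moreover have "monotonicity_condition Q"
    unfolding monotonicity_condition_def
  proof (intro ballI allI impI)
    fix u :: "real ^ 'n" and i t assume "u $ i \<le> t"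
    then have "excess u (\<chi> k. if k = i then t else u $ k) = 0"
      by (intro excess_eq_0) simp
    then show "Q u \<le> Q (\<chi> k. if k = i then t else u $ k)"
      using excess[of u "\<chi> k. if k = i then t else u $ k"] by simp
  qed
  moreover have "lipschitz_condition Q"
    unfolding lipschitz_condition_def
  proof (intro ballI)
    fix u v :: "real ^ 'n"
    have "(\<Sum>k\<in>UNIV. \<bar>v $ k - u $ k\<bar>) = (\<Sum>k\<in>UNIV. \<bar>u $ k - v $ k\<bar>)"
      by (simp add: abs_minus_commute)
    then show "\<bar>Q u - Q v\<bar> \<le> (\<Sum>k\<in>UNIV. \<bar>u $ k - v $ k\<bar>)"
      using excess[of u v] excess[of v u] excess_le_l1[of u v] excess_le_l1[of v u] by linarith
  qed
  ultimately show ?thesis by (simp add: quasi_copula_def)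
qed

text \<open>Indexing by subsets turns joins of multi-indices into unions and cube edges into
  \<open>insert\<close>, so that edge paths become finite set induction.\<close>

definition indicator_index :: "'n::finite set \<Rightarrow> int ^ 'n" where
  "indicator_index S = (\<chi> k. if k \<in> S then 1 else 0)"

lemma binary_indices_eq_range: "binary_indices = range indicator_index"
proof (intro equalityI subsetI)
  fix I :: "int ^ 'n" assume "I \<in> binary_indices"
  then have "\<And>k. I $ k = 0 \<or> I $ k = 1" by (simp add: binary_indices_def)
  then have "I = indicator_index {k. I $ k = 1}"
    by (auto simp: indicator_index_def vec_eq_iff)
  then show "I \<in> range indicator_index" by blast
qed (auto simp: binary_indices_def indicator_index_def)

lemma adjacent_at_insert:
  "l \<notin> S \<Longrightarrow> adjacent_at l (indicator_index S) (indicator_index (insert l S))"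
  by (auto simp: adjacent_at_def indicator_index_def vec_eq_iff axis_def)

lemma vertex_indicator_index: "vertex a (indicator_index S) $ k = (if k \<in> S then 1 else a $ k)"
  by (simp add: vertex_def indicator_index_def)

text \<open>On \<open>S - T\<close> the difference is \<open>a $ k - 1\<close>, which is cut off at
  0; where membership in \<open>S\<close> and \<open>T\<close> agrees it vanishes.\<close>

lemma excess_vertices:
  assumes "\<And>k. a $ k \<le> 1"
  shows "excess (vertex a (indicator_index T)) (vertex a (indicator_index S)) =
    (\<Sum>k\<in>T - S. 1 - a $ k)"
proof -
  have "excess (vertex a (indicator_index T)) (vertex a (indicator_index S)) =
      (\<Sum>k\<in>UNIV. if k \<in> T - S then 1 - a $ k else 0)"
    unfolding excess_def vertex_indicator_index by (intro sum.cong) (auto simp: assms)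
  also have "\<dots> = (\<Sum>k\<in>T - S. 1 - a $ k)"
    by (simp add: sum.If_cases set_diff_eq)
  finally show ?thesis .
qed

text \<open>Add the elements of \<open>T\<close> to \<open>S\<close> one at a time: those already in
  \<open>S\<close> change nothing, each other \<open>l\<close> costs between 0 and
  \<open>w l\<close>.\<close>

lemma set_function_union_bounds:
  fixes p :: "'a set \<Rightarrow> real"
  assumes step: "\<And>l S. l \<notin> S \<Longrightarrow> 0 \<le> p (insert l S) - p S \<and> p (insert l S) - p S \<le> w l"
    and "finite T"
  shows "p S \<le> p (S \<union> T) \<and> p (S \<union> T) \<le> p S + sum w (T - S)"
  using \<open>finite T\<close>
proof induction
  case (insert l T)
  show ?case
  proof (cases "l \<in> S")
    case True
    then have "S \<union> insert l T = S \<union> T" "insert l T - S = T - S" by auto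
    with insert show ?thesis by simp
  next
    case False
    then have "sum w (insert l T - S) = w l + sum w (T - S)"
      using insert by (simp add: insert_Diff_if)
    with insert step[of l "S \<union> T"] False show ?thesis by simp
  qed
qed simp

theorem theorem2p1:
  fixes a :: "real ^ 'n::finite" and q :: "int ^ 'n \<Rightarrow> real"
  assumes "CARD('n) \<ge> 2"
    and "\<And>i. a $ i \<in> {0..<1}"
    and "\<And>I. I \<in> binary_indices \<Longrightarrow> q I \<in> {0..1}"
    and "\<And>l I J. I \<in> binary_indices \<Longrightarrow> J \<in> binary_indices \<Longrightarrow> adjacent_at l I J \<Longrightarrow>
           0 \<le> q J - q I \<and> q J - q I \<le> 1 - a $ l"
    and "\<And>I. I \<in> binary_indices \<Longrightarrow> G (vertex a I) \<le> q I \<and> q I \<le> H (vertex a I)"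
  shows "\<exists>Q :: real ^ 'n \<Rightarrow> real. quasi_copula Q \<and> (\<forall>I\<in>binary_indices. Q (vertex a I) = q I)"
proof -
  define x where "x S = vertex a (indicator_index S)" for S
  define p where "p S = q (indicator_index S)" for S
  \<comment> \<open>A one-sided McShane extension of the prescribed values.\<close>
  define M where "M u = Min (range (\<lambda>S. p S + excess u (x S)))" for u
  define Q where "Q u = min (H u) (M u)" for u
  have bin: "indicator_index S \<in> binary_indices" for S :: "'n set"
    by (simp add: binary_indices_eq_range)
  have a_le_1: "a $ k \<le> 1" for k
    using assms(2)[of k] by simp
  have p_nonneg: "0 \<le> p S" for S
    using assms(3)[OF bin[of S]] by (simp add: p_def)
  have p_bounds: "G (x S) \<le> p S" "p S \<le> H (x S)" for S
    using assms(5)[OF bin[of S]] by (simp_all add: p_def x_def)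
  have p_le: "p T \<le> p S + excess (x T) (x S)" for S T
  proof -
    have step: "0 \<le> p (insert l S) - p S \<and> p (insert l S) - p S \<le> 1 - a $ l" if "l \<notin> S" for l S
      using assms(4)[OF bin bin adjacent_at_insert[OF that]] by (simp add: p_def)
    \<comment> \<open>The path goes through the join: from \<open>T\<close> up to it only
      monotonicity is used, from \<open>S\<close> up to it only the upper increments, summed over
      \<open>T - S\<close>.\<close>
    have "p T \<le> p (T \<union> S)"
      using set_function_union_bounds[of p "\<lambda>l. 1 - a $ l" S T] step by simp
    also have "\<dots> \<le> p S + (\<Sum>k\<in>T - S. 1 - a $ k)"
      using set_function_union_bounds[of p "\<lambda>l. 1 - a $ l" T S] step by (simp add: Un_commute)
    finally show ?thesis by (simp add: x_def excess_vertices[OF a_le_1])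
  qed
  have M_ge: "c \<le> M u" if "\<And>S. c \<le> p S + excess u (x S)" for c u
    unfolding M_def using that by (subst Min_ge_iff) auto
  have M_le: "M u \<le> M v + excess u v" for u v
    unfolding M_def
  proof (rule Min_range_le_add)
    show "p S + excess u (x S) \<le> p S + excess v (x S) + excess u v" for S
      using excess_triangle[of u "x S" v] by simp
  qed
  have "quasi_copula Q"
  proof (rule quasi_copulaI)
    show "Q u \<le> Q v + excess u v" for u v
      using M_le[of u v] H_le_add_excess[of u v] by (auto simp: Q_def)
    show "0 \<le> Q u" if "u \<in> unit_cube" for u
    proof -
      have "0 \<le> H u" using that unfolding H_def unit_cube_def by (subst Min_ge_iff) auto
      moreover have "0 \<le> M u" by (intro M_ge add_nonneg_nonneg p_nonneg excess_nonneg)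
      ultimately show ?thesis by (simp add: Q_def)
    qed
    show "Q u \<le> H u" for u by (simp add: Q_def)
    show "t \<le> Q (\<chi> k. if k = i then t else 1)" (is "_ \<le> Q ?u") if t: "t \<in> {0..1}" for i t
    proof -
      have "t \<le> H ?u" using t unfolding H_def by (subst Min_ge_iff) auto
      moreover have "t \<le> M ?u"
      proof (rule M_ge)
        fix S
        \<comment> \<open>This sum shows that \<open>G ?u\<close> is \<open>t\<close>. As
          \<open>G\<close> grows by at most the excess and \<open>G (x S) \<le> p S\<close>, the
          bound follows.\<close>
        have "(\<Sum>k\<in>UNIV. ?u $ k) = t + (\<Sum>k\<in>UNIV - {i}. 1)"
          by (subst sum.remove[of _ i]) auto
        also have "\<dots> = t + real CARD('n) - 1"
          by (simp add: card_Diff_singleton of_nat_diff Suc_le_eq)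
        finally have "t = (\<Sum>k\<in>UNIV. ?u $ k) - real CARD('n) + 1" by simp
        then show "t \<le> p S + excess ?u (x S)"
          using sum_diff_le_excess[of ?u "x S"] p_bounds(1)[of S] by (simp add: G_def)
      qed
      ultimately show ?thesis by (simp add: Q_def)
    qed
  qed
  moreover have "Q (x T) = p T" for T
  proof (rule antisym)
    \<comment> \<open>The term with \<open>S = T\<close> attains the prescribed value; by
      \<open>p_le\<close> no other term is smaller, and \<open>p T \<le> H (x T)\<close> keeps
      \<open>H\<close> from cutting it off.\<close>
    have "M (x T) \<le> p T + excess (x T) (x T)" unfolding M_def by (intro Min_le) auto
    then show "Q (x T) \<le> p T" by (simp add: Q_def excess_eq_0)
    show "p T \<le> Q (x T)" using M_ge[OF p_le] p_bounds(2)[of T] by (simp add: Q_def)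
  qed
  ultimately show ?thesis
    unfolding binary_indices_eq_range x_def p_def by blast
qed

end
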